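(* Let $G$ be a group generated by a finite set $X$. If $G$ contains seesaw elements of arbitrary swing with respect to $X$, then $G$ has no regular language of geodesics with respect to $X$.
   Context: Let $|\cdot|$ be word length in $G$ with respect to the finite generating set $X$. An element $w\in G$ is a seesaw element of swing $k$ with respect to a generator $g\in X$ if: (1) $|wg^{\pm1}|=|w|-1$, and $|wh^{\pm1}|\ge|w|$ for all $h\in X\smallsetminus\{g^{\pm1}\}$; (2) $|wg^{l}|=|wg^{l-1}|-1$ for all integers $l\in[1,k]$, and $|wg^{m}h^{\pm1}|\ge|wg^{m}|$ for all $h\in X\smallsetminus\{g^{\pm1}\}$ and all integers $m\in[1,k-1]$; (3) $|wg^{-l}|=|wg^{-l+1}|-1$ for all integers $l\in[1,k]$, and $|wg^{-m}h^{\pm1}|\ge|wg^{-m}|$ for all $h\in X\smallsetminus\{g^{\pm1}\}$ and all integers $m\in[1,k-1]$. "$G$ contains seesaw elements of arbitrary swing with respect to $X$" means that for every positive integer $k$ there is an element of $G$ that is a seesaw element of swing $k$ with respect to some generator in $X$. Words are finite strings over the alphabet $X\cup X^{-1}$; a word is geodesic if its length equals the word length of the element it represents. A language of geodesics for $G$ with respect to $X$ is a set of geodesic words containing at least one representative of each element of $G$. A language is regular if it is accepted by a finite state automaton. *)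

theory Defs
  imports "HOL-Algebra.Generated_Groups"
begin

text \<open>Letters are group elements, so \<open>g\<close> and its inverse are the same letter exactly when they
  are equal in the group.\<close>

definition letters :: "('a, 'b) monoid_scheme \<Rightarrow> 'a set \<Rightarrow> 'a set" where
  "letters G X = X \<union> (\<lambda>x. inv\<^bsub>G\<^esub> x) ` X"

definition word_value :: "('a, 'b) monoid_scheme \<Rightarrow> 'a list \<Rightarrow> 'a" where
  "word_value G us = foldr (\<lambda>x y. x \<otimes>\<^bsub>G\<^esub> y) us \<one>\<^bsub>G\<^esub>"

text \<open>Meaningful for elements of the subgroup generated by \<open>X\<close>; elsewhere the
  minimum ranges over the empty set and the value is unspecified.\<close>

definition word_length :: "('a, 'b) monoid_scheme \<Rightarrow> 'a set \<Rightarrow> 'a \<Rightarrow> nat" where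
  "word_length G X a =
     (LEAST n. \<exists>us \<in> lists (letters G X). word_value G us = a \<and> length us = n)"

definition geodesic_word :: "('a, 'b) monoid_scheme \<Rightarrow> 'a set \<Rightarrow> 'a list \<Rightarrow> bool" where
  "geodesic_word G X us \<longleftrightarrow>
     us \<in> lists (letters G X) \<and> length us = word_length G X (word_value G us)"

definition language_of_geodesics ::
    "('a, 'b) monoid_scheme \<Rightarrow> 'a set \<Rightarrow> 'a list set \<Rightarrow> bool" where
  "language_of_geodesics G X L \<longleftrightarrow>
     (\<forall>us \<in> L. geodesic_word G X us) \<and>
     (\<forall>a \<in> carrier G. \<exists>us \<in> L. word_value G us = a)"

text \<open>Acceptance by a deterministic finite automaton with state set \<open>Q\<close>, transition
  function \<open>\<delta>\<close>, initial state \<open>q\<^sub>0\<close> and accepting states \<open>F\<close>. Taking the states to be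
  natural numbers loses nothing, since a finite state set can be renumbered.\<close>

definition regular_language :: "'a set \<Rightarrow> 'a list set \<Rightarrow> bool" where
  "regular_language A L \<longleftrightarrow>
     (\<exists>(Q :: nat set) \<delta> q\<^sub>0 F.
        finite Q \<and> q\<^sub>0 \<in> Q \<and> F \<subseteq> Q \<and> (\<forall>q \<in> Q. \<forall>a \<in> A. \<delta> q a \<in> Q) \<and>
        L = {us \<in> lists A. foldl \<delta> q\<^sub>0 us \<in> F})"

text \<open>Lengths are compared in \<^typ>\<open>int\<close> so that subtracting one does not truncate at zero.\<close>

definition seesaw_element ::
    "('a, 'b) monoid_scheme \<Rightarrow> 'a set \<Rightarrow> 'a \<Rightarrow> int \<Rightarrow> 'a \<Rightarrow> bool" where
  "seesaw_element G X w k g \<longleftrightarrow>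
     (let len = (\<lambda>a. int (word_length G X a)); H = X - {g, inv\<^bsub>G\<^esub> g} in
      w \<in> carrier G \<and> g \<in> X \<and>
      len (w \<otimes>\<^bsub>G\<^esub> g) = len w - 1 \<and>
      len (w \<otimes>\<^bsub>G\<^esub> inv\<^bsub>G\<^esub> g) = len w - 1 \<and>
      (\<forall>h \<in> H. len (w \<otimes>\<^bsub>G\<^esub> h) \<ge> len w \<and> len (w \<otimes>\<^bsub>G\<^esub> inv\<^bsub>G\<^esub> h) \<ge> len w) \<and>
      (\<forall>l \<in> {1..k}.
         len (w \<otimes>\<^bsub>G\<^esub> (g [^]\<^bsub>G\<^esub> l)) = len (w \<otimes>\<^bsub>G\<^esub> (g [^]\<^bsub>G\<^esub> (l - 1))) - 1) \<and>
      (\<forall>m \<in> {1..k - 1}. \<forall>h \<in> H.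
         len (w \<otimes>\<^bsub>G\<^esub> (g [^]\<^bsub>G\<^esub> m) \<otimes>\<^bsub>G\<^esub> h) \<ge> len (w \<otimes>\<^bsub>G\<^esub> (g [^]\<^bsub>G\<^esub> m)) \<and>
         len (w \<otimes>\<^bsub>G\<^esub> (g [^]\<^bsub>G\<^esub> m) \<otimes>\<^bsub>G\<^esub> inv\<^bsub>G\<^esub> h) \<ge> len (w \<otimes>\<^bsub>G\<^esub> (g [^]\<^bsub>G\<^esub> m))) \<and>
      (\<forall>l \<in> {1..k}.
         len (w \<otimes>\<^bsub>G\<^esub> (g [^]\<^bsub>G\<^esub> (- l))) = len (w \<otimes>\<^bsub>G\<^esub> (g [^]\<^bsub>G\<^esub> (- l + 1))) - 1) \<and>
      (\<forall>m \<in> {1..k - 1}. \<forall>h \<in> H.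
         len (w \<otimes>\<^bsub>G\<^esub> (g [^]\<^bsub>G\<^esub> (- m)) \<otimes>\<^bsub>G\<^esub> h) \<ge> len (w \<otimes>\<^bsub>G\<^esub> (g [^]\<^bsub>G\<^esub> (- m))) \<and>
         len (w \<otimes>\<^bsub>G\<^esub> (g [^]\<^bsub>G\<^esub> (- m)) \<otimes>\<^bsub>G\<^esub> inv\<^bsub>G\<^esub> h) \<ge> len (w \<otimes>\<^bsub>G\<^esub> (g [^]\<^bsub>G\<^esub> (- m)))))"

definition seesaws_of_arbitrary_swing :: "('a, 'b) monoid_scheme \<Rightarrow> 'a set \<Rightarrow> bool" where
  "seesaws_of_arbitrary_swing G X \<longleftrightarrow>
     (\<forall>k > 0. \<exists>w \<in> carrier G. \<exists>g \<in> X. seesaw_element G X w k g)"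

end

theory Submission
  imports Defs
begin

text \<open>Let \<open>w\<close> be a seesaw element of swing \<open>k\<close> with respect to \<open>g\<close>. The last letter of a
  geodesic word for \<open>w\<close> can only be \<open>g\<close> or its inverse, and once it is chosen the next
  \<open>k - 1\<close> letters from the right are forced to agree with it, so the word is \<open>u t\<^sup>k\<close> with
  \<open>t \<in> {g, g\<inverse>}\<close>. If \<open>k\<close> is at least the number of states of an automaton for a language of
  geodesics, pumping inside \<open>t\<^sup>k\<close> shows that \<open>u t\<^bsup>k + p\<^esup>\<close> is also in the language for some
  \<open>1 \<le> p \<le> k\<close>. It is thus geodesic, so \<open>w t\<^sup>p\<close> has length \<open>\<bar>w\<bar> + p\<close>, whereas the seesaw
  property gives \<open>\<bar>w\<bar> - p\<close>.\<close>

text \<open>Among the states reached after \<open>us\<close> followed by 0, ...,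
  \<open>card Q\<close> copies of \<open>t\<close>, two coincide by pigeonhole, and the loop between
  them can be run once more. The bound \<open>n\<close> is independent of the word and also bounds
  \<open>p\<close>, so a pumped seesaw word will not overshoot an arm.\<close>

lemma regular_language_pump_power:
  assumes "regular_language A L"
  obtains n where "\<And>us t k. n \<le> k \<Longrightarrow> us @ replicate k t \<in> L \<Longrightarrow>
    \<exists>p\<in>{1..n}. us @ replicate (k + p) t \<in> L"
proof -
  obtain Q :: "nat set" and d q0 F where Q: "finite Q" "q0 \<in> Q" "F \<subseteq> Q"
      "\<forall>q \<in> Q. \<forall>a \<in> A. d q a \<in> Q" and L: "L = {us \<in> lists A. foldl d q0 us \<in> F}"
    using assms unfolding regular_language_def by blast
  have run: "foldl d q us \<in> Q" if "us \<in> lists A" "q \<in> Q" for us q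
    using that Q(4) by (induction us arbitrary: q) auto
  have pos: "card Q > 0" using Q by (auto simp: card_gt_0_iff)
  show thesis
  proof (rule that[of "card Q"])
    fix us t k assume k: "card Q \<le> k" and word: "us @ replicate k t \<in> L"
    let ?f = "\<lambda>i. foldl d q0 (us @ replicate i t)"
    \<comment> \<open>Since \<open>k\<close> is at least \<open>card Q > 0\<close>, the letter
      \<open>t\<close> really occurs in the given word, hence lies in \<open>A\<close>.\<close>
    have lists: "us @ replicate i t \<in> lists A" for i
      using word k pos by (auto simp: L)
    have "?f ` {..card Q} \<subseteq> Q" using run[OF lists Q(2)] by blast
    then have "card (?f ` {..card Q}) < card {..card Q}"
      using card_mono[OF Q(1)] by (metis card_atMost less_Suc_eq_le)
    then have "\<not> inj_on ?f {..card Q}" by (rule pigeonhole)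
    then obtain i j where ij: "i < j" "j \<le> card Q" "?f i = ?f j"
      unfolding inj_on_def by (metis atMost_iff linorder_neqE_nat)
    have split: "?f (l + m) = foldl d (?f l) (replicate m t)" for l m
      by (simp add: replicate_add)
    \<comment> \<open>From the common state after \<open>i\<close> or \<open>j\<close> copies, both
      runs read the same \<open>k - i\<close> remaining letters.\<close>
    have "k + (j - i) = j + (k - i)" "k = i + (k - i)" using ij k by auto
    then have "?f (k + (j - i)) = ?f k"
      using split[of j "k - i"] split[of i "k - i"] ij(3) by metis
    then have "us @ replicate (k + (j - i)) t \<in> L"
      using lists word by (simp add: L)
    then show "\<exists>p\<in>{1..card Q}. us @ replicate (k + p) t \<in> L"
      using ij by (intro bexI[of _ "j - i"]) auto
  qed
qed

context group
begin

lemma letters_closed: "X \<subseteq> carrier G \<Longrightarrow> letters G X \<subseteq> carrier G"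
  by (auto simp: letters_def)

lemma inv_letter: "X \<subseteq> carrier G \<Longrightarrow> a \<in> letters G X \<Longrightarrow> inv a \<in> letters G X"
  by (auto simp: letters_def subset_iff)

lemma word_value_closed: "set us \<subseteq> carrier G \<Longrightarrow> word_value G us \<in> carrier G"
  by (induction us) (auto simp: word_value_def)

lemma word_value_append:
  assumes "set us \<subseteq> carrier G" "set vs \<subseteq> carrier G"
  shows "word_value G (us @ vs) = word_value G us \<otimes> word_value G vs"
  using assms
proof (induction us)
  case Nil
  then show ?case using word_value_closed[of vs] by (simp add: word_value_def)
next
  case (Cons a us)
  then show ?case using word_value_closed[of us] word_value_closed[of vs]
    by (simp add: word_value_def m_assoc)
qed

lemma word_value_replicate: "a \<in> carrier G \<Longrightarrow> word_value G (replicate n a) = a [^] n"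
proof (induction n)
  case (Suc n)
  then show ?case using nat_pow_Suc2[of a n] by (simp add: word_value_def)
qed (simp add: word_value_def)

lemma geodesic_word_closed:
  "X \<subseteq> carrier G \<Longrightarrow> geodesic_word G X us \<Longrightarrow> set us \<subseteq> carrier G"
  using letters_closed by (auto simp: geodesic_word_def)

lemma word_length_le:
  "us \<in> lists (letters G X) \<Longrightarrow> word_length G X (word_value G us) \<le> length us"
  unfolding word_length_def by (rule Least_le) blast

lemma geodesic_word_exists:
  assumes "us \<in> lists (letters G X)"
  obtains vs where "geodesic_word G X vs" "word_value G vs = word_value G us"
proof -
  have "\<exists>vs\<in>lists (letters G X). word_value G vs = word_value G us
          \<and> length vs = word_length G X (word_value G us)"
    unfolding word_length_def by (rule LeastI_ex) (use assms in blast)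
  then show thesis using that by (auto simp: geodesic_word_def)
qed

text \<open>Replacing the prefix by a shorter word of the same value would shorten the whole
  word.\<close>

lemma geodesic_word_appendD:
  assumes X: "X \<subseteq> carrier G" and geo: "geodesic_word G X (us @ vs)"
  shows "geodesic_word G X us"
proof -
  have lists: "us \<in> lists (letters G X)" "vs \<in> lists (letters G X)"
    using geo by (auto simp: geodesic_word_def)
  obtain us' where us': "geodesic_word G X us'" "word_value G us' = word_value G us"
    using geodesic_word_exists[OF lists(1)] .
  have sub: "set us \<subseteq> carrier G" "set us' \<subseteq> carrier G" "set vs \<subseteq> carrier G"
    using geodesic_word_closed[OF X geo] geodesic_word_closed[OF X us'(1)] by auto
  have lists': "us' @ vs \<in> lists (letters G X)"
    using us' lists by (auto simp: geodesic_word_def)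
  have "word_value G (us' @ vs) = word_value G (us @ vs)"
    using sub us' by (simp add: word_value_append)
  then have "length (us @ vs) \<le> length (us' @ vs)"
    using geo word_length_le[OF lists'] by (simp add: geodesic_word_def)
  then show ?thesis
    using us' lists(1) word_length_le[OF lists(1)] by (simp add: geodesic_word_def)
qed

text \<open>Peels off the last letter \<open>a\<close> and records that \<open>inv a\<close>
  decreases the length, which is the form in which the seesaw conditions can restrict
  \<open>a\<close>.\<close>

lemma geodesic_word_snocE:
  assumes X: "X \<subseteq> carrier G" and geo: "geodesic_word G X us"
    and "word_length G X (word_value G us) > 0"
  obtains vs a where "us = vs @ [a]" "geodesic_word G X vs" "a \<in> letters G X"
    "word_value G vs = word_value G us \<otimes> inv a"
    "Suc (word_length G X (word_value G us \<otimes> inv a)) = word_length G X (word_value G us)"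
proof -
  have "us \<noteq> []" using assms(3) geo by (auto simp: geodesic_word_def)
  then obtain vs a where us: "us = vs @ [a]" by (metis append_butlast_last_id)
  have vs: "geodesic_word G X vs" using geodesic_word_appendD[OF X] geo us by blast
  have sub: "set vs \<subseteq> carrier G" "a \<in> carrier G"
    using geodesic_word_closed[OF X geo] us by auto
  have "word_value G us = word_value G vs \<otimes> a"
    using sub by (simp add: us word_value_append) (simp add: word_value_def)
  then have "word_value G vs = word_value G us \<otimes> inv a"
    using sub word_value_closed[OF sub(1)] by (simp add: m_assoc)
  then show thesis
    using that[OF us vs] geo vs us by (auto simp: geodesic_word_def)
qed

text \<open>\<open>desc\<close> and \<open>rigid\<close> describe one arm of a seesaw; \<open>rigid\<close> stops short of the tip
  \<open>m = k\<close>, where the geodesic may leave the arm.\<close>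

lemma geodesic_ends_with_power:
  assumes X: "X \<subseteq> carrier G" and s: "s \<in> carrier G" and w: "w \<in> carrier G"
    and geo: "geodesic_word G X (us @ [inv s])" "word_value G (us @ [inv s]) = w"
    and desc: "\<And>l. l \<le> k \<Longrightarrow> word_length G X (w \<otimes> s [^] l) + l = word_length G X w"
    and rigid: "\<And>m a. 0 < m \<Longrightarrow> m < k \<Longrightarrow> a \<in> letters G X - {s, inv s} \<Longrightarrow>
      word_length G X (w \<otimes> s [^] m) \<le> word_length G X (w \<otimes> s [^] m \<otimes> a)"
    and m: "0 < m" "m \<le> k"
  shows "\<exists>vs. us @ [inv s] = vs @ replicate m (inv s)"
  using m
proof (induction m rule: nat_induct_non_zero)
  case 1
  then show ?case by simp
next
  case (Suc m)
  then obtain vs where vs: "us @ [inv s] = vs @ replicate m (inv s)" by auto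
  have vgeo: "geodesic_word G X vs"
    using geodesic_word_appendD[OF X] geo(1) unfolding vs by blast
  have sub: "set vs \<subseteq> carrier G" using geodesic_word_closed[OF X vgeo] .
  have "set (replicate m (inv s)) \<subseteq> carrier G" using s by auto
  then have "w = word_value G vs \<otimes> inv (s [^] m)"
    using word_value_append[OF sub] geo(2) vs s
    by (simp add: word_value_replicate nat_pow_inv)
  then have val: "word_value G vs = w \<otimes> s [^] m"
    using s word_value_closed[OF sub] by (simp add: m_assoc)
  \<comment> \<open>The descent continues to \<open>Suc m\<close>, which is still at most
    \<open>k\<close>, so another letter can be peeled off.\<close>
  have "word_length G X (w \<otimes> s [^] m) > 0"
    using desc[of m] desc[of "Suc m"] Suc by simp
  then obtain us' a where a: "vs = us' @ [a]" "a \<in> letters G X"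
    "Suc (word_length G X (w \<otimes> s [^] m \<otimes> inv a)) = word_length G X (w \<otimes> s [^] m)"
    using geodesic_word_snocE[OF X vgeo] val by metis
  have "inv a \<in> {s, inv s}"
    using rigid[of m "inv a"] inv_letter[OF X a(2)] a(3) Suc by force
  \<comment> \<open>Multiplying by \<open>inv s\<close> moves back along the arm towards
    \<open>w\<close>, where the length is larger.\<close>
  moreover have "inv a \<noteq> inv s"
  proof
    assume eq: "inv a = inv s"
    obtain m' where m': "m = Suc m'" using Suc by (cases m) auto
    have "w \<otimes> s [^] m \<otimes> inv a = w \<otimes> s [^] m'"
      using s w by (simp add: eq m' m_assoc)
    then show False using a(3) desc[of m] desc[of m'] Suc m' by simp
  qed
  ultimately have "a = inv s"
    using a(2) letters_closed[OF X] by (metis empty_iff insert_iff inv_inv subsetD)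
  then have "us @ [inv s] = us' @ replicate (Suc m) (inv s)"
    using vs a by (simp add: replicate_app_Cons_same)
  then show ?case by blast
qed

text \<open>Treats both arms at once: natural powers of \<open>s\<close> replace integer powers of
  \<open>g\<close> of either sign, and the excluded letters are the same for both choices of
  \<open>s\<close>. Allowing \<open>m = 0\<close> absorbs the condition at \<open>w\<close> itself,
  and the additive form of the descent avoids truncated subtraction.\<close>

lemma seesaw_element_arm:
  assumes X: "X \<subseteq> carrier G" and see: "seesaw_element G X w (int k) g"
    and s: "s \<in> {g, inv g}"
  shows "l \<le> k \<Longrightarrow> word_length G X (w \<otimes> s [^] l) + l = word_length G X w"
    and "m < k \<Longrightarrow> a \<in> letters G X - {s, inv s} \<Longrightarrow>
      word_length G X (w \<otimes> s [^] m) \<le> word_length G X (w \<otimes> s [^] m \<otimes> a)"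
proof -
  have g: "g \<in> X" "g \<in> carrier G" and w: "w \<in> carrier G"
    using see X by (auto simp: seesaw_element_def Let_def)
  have pow: "inv g [^] n = g [^] (- int n)" "g [^] n = g [^] int n" for n :: nat
    using g by (simp_all add: int_pow_neg_int int_pow_int nat_pow_inv)
  have step: "word_length G X (w \<otimes> s [^] Suc l) + 1 = word_length G X (w \<otimes> s [^] l)"
    if "Suc l \<le> k" for l
  proof -
    have "int (Suc l) \<in> {1..int k}" using that by auto
    then have "int (word_length G X (w \<otimes> (g [^] int (Suc l))))
        = int (word_length G X (w \<otimes> (g [^] (int (Suc l) - 1)))) - 1"
      "int (word_length G X (w \<otimes> (g [^] (- int (Suc l)))))
        = int (word_length G X (w \<otimes> (g [^] (- int (Suc l) + 1)))) - 1"
      using see unfolding seesaw_element_def Let_def by blast+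
    moreover have "int (Suc l) - 1 = int l" "- int (Suc l) + 1 = - int l" by simp_all
    ultimately show ?thesis using s by (auto simp only: pow)
  qed
  show "l \<le> k \<Longrightarrow> word_length G X (w \<otimes> s [^] l) + l = word_length G X w"
  proof (induction l)
    case (Suc l)
    then show ?case using step[of l] by simp
  qed (use w in simp)
  assume m: "m < k" and a: "a \<in> letters G X - {s, inv s}"
  have pair: "{s, inv s} = {g, inv g}" using s g by auto
  obtain h where h: "h \<in> X - {g, inv g}" "a = h \<or> a = inv h"
  proof (cases "a \<in> X")
    case False
    then obtain x where x: "x \<in> X" "a = inv x" using a by (auto simp: letters_def)
    then have "x \<notin> {g, inv g}" using a g unfolding pair by auto
    then show thesis using that x by blast
  qed (use a that in \<open>auto simp: pair\<close>)
  show "word_length G X (w \<otimes> s [^] m) \<le> word_length G X (w \<otimes> s [^] m \<otimes> a)"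
  proof (cases "m = 0")
    case True
    then show ?thesis using h see w unfolding seesaw_element_def Let_def by auto
  next
    case False
    then have "int m \<in> {1..int k - 1}" using m by auto
    then have
      "int (word_length G X (w \<otimes> (g [^] int m) \<otimes> a)) \<ge> int (word_length G X (w \<otimes> (g [^] int m)))"
      "int (word_length G X (w \<otimes> (g [^] (- int m)) \<otimes> a)) \<ge> int (word_length G X (w \<otimes> (g [^] (- int m))))"
      using see h unfolding seesaw_element_def Let_def by blast+
    then show ?thesis using s by (auto simp only: pow)
  qed
qed

text \<open>Only \<open>g\<close> and \<open>inv g\<close> shorten \<open>w\<close>, so the last
  letter selects an arm, and rigidity along that arm forces the rest. The repeated letter is
  \<open>inv s\<close> because the word climbs from the tip \<open>w \<otimes> s [^] k\<close> back
  to \<open>w\<close>.\<close>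

lemma geodesic_seesaw_form:
  assumes X: "X \<subseteq> carrier G" and see: "seesaw_element G X w (int k) g" and "0 < k"
    and geo: "geodesic_word G X us" "word_value G us = w"
  obtains s vs where "s \<in> {g, inv g}" "us = vs @ replicate k (inv s)"
proof -
  have g: "g \<in> carrier G" and w: "w \<in> carrier G"
    using see X by (auto simp: seesaw_element_def Let_def)
  have "word_length G X w > 0"
    using seesaw_element_arm(1)[OF X see, of g k] \<open>0 < k\<close> by simp
  then obtain vs a where vs: "us = vs @ [a]" "a \<in> letters G X"
    "Suc (word_length G X (w \<otimes> inv a)) = word_length G X w"
    using geodesic_word_snocE[OF X geo(1)] geo(2) by metis
  have "inv a \<in> {g, inv g}"
    using seesaw_element_arm(2)[OF X see, of g 0 "inv a"] inv_letter[OF X vs(2)] vs(3) w \<open>0 < k\<close>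
    by force
  then obtain s where s: "s \<in> {g, inv g}" "a = inv s"
    using vs(2) letters_closed[OF X] by (metis inv_inv subsetD)
  have "s \<in> carrier G" using s g by auto
  from geodesic_ends_with_power[OF X this w, of vs k k] geo s vs(1) \<open>0 < k\<close>
    seesaw_element_arm[OF X see s(1)]
  show thesis using that[OF s(1)] by blast
qed

end

theorem theorem30:
  fixes G (structure) and X :: "'a set"
  assumes "group G"
    and "finite X"
    and "X \<subseteq> carrier G"
    and "generate G X = carrier G"
    and "seesaws_of_arbitrary_swing G X"
  shows "\<not> (\<exists>L. language_of_geodesics G X L \<and> regular_language (letters G X) L)"
proof
  interpret group G by fact
  note X = \<open>X \<subseteq> carrier G\<close>
  assume "\<exists>L. language_of_geodesics G X L \<and> regular_language (letters G X) L"
  then obtain L where geo: "\<And>us. us \<in> L \<Longrightarrow> geodesic_word G X us"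
    and onto: "\<And>a. a \<in> carrier G \<Longrightarrow> \<exists>us\<in>L. word_value G us = a"
    and reg: "regular_language (letters G X) L"
    by (auto simp: language_of_geodesics_def)
  obtain n where pump: "\<And>us t k. n \<le> k \<Longrightarrow> us @ replicate k t \<in> L \<Longrightarrow>
      \<exists>p\<in>{1..n}. us @ replicate (k + p) t \<in> L"
    using regular_language_pump_power[OF reg] by blast
  \<comment> \<open>Swing \<open>Suc n\<close> is positive even if \<open>n = 0\<close>, long enough
    to pump, and at least every possible \<open>p\<close>.\<close>
  obtain w g where w: "w \<in> carrier G" and g: "g \<in> X"
    and see: "seesaw_element G X w (int (Suc n)) g"
    using assms(5) unfolding seesaws_of_arbitrary_swing_def
    by (metis of_nat_0_less_iff zero_less_Suc)
  obtain us where us: "us \<in> L" "word_value G us = w" using onto[OF w] by blast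
  obtain s vs where s: "s \<in> {g, inv g}" and vs: "us = vs @ replicate (Suc n) (inv s)"
    using geodesic_seesaw_form[OF X see _ geo[OF us(1)] us(2)] by blast
  obtain p where p: "p \<in> {1..n}" "vs @ replicate (Suc n + p) (inv s) \<in> L"
    using pump[of "Suc n" vs "inv s"] us(1) vs by auto
  have long: "us @ replicate p (inv s) \<in> L"
    using p(2) by (simp add: vs replicate_add)
  \<comment> \<open>The word reaches \<open>w\<close> by climbing the arm of \<open>s\<close>; the
    extra letters \<open>inv s\<close> carry on past \<open>w\<close> down the opposite arm, where
    the length falls again.\<close>
  have t: "inv s \<in> {g, inv g}" "inv s \<in> carrier G" using s g X by auto
  have "word_value G (us @ replicate p (inv s)) = w \<otimes> inv s [^] p"
    using t us(2) geodesic_word_closed[OF X geo[OF us(1)]]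
    by (subst word_value_append) (auto simp: word_value_replicate)
  then have "word_length G X (w \<otimes> inv s [^] p) = word_length G X w + p"
    using geo[OF long] geo[OF us(1)] us(2) by (simp add: geodesic_word_def)
  moreover have "word_length G X (w \<otimes> inv s [^] p) + p = word_length G X w"
    using seesaw_element_arm(1)[OF X see t(1)] p(1) by simp
  ultimately show False using p(1) by simp
qed

end
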